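(* Let $K$ be a finite simplicial mesh of an $n$-dimensional domain in $\mathbb{R}^n$ and let $0\le k\le n$. For a $k$-simplex $\sigma^k$ of $K$, let $A(\sigma^k)$ denote the number of $n$-simplices in $K$ incident on at least one vertex from $\sigma^k$. Let $\mathbb{M}_k^{Whit}$ be the Whitney discrete Hodge star of $K$, and let $(\mathbb{M}_k^{Dual})^{-1}$ be the dual discrete Hodge star (defined for $n=3$). Then the number of non-zero entries in row $i$ of $\mathbb{M}_k^{Whit}$ is at most $\binom{n+1}{k+1}A(\sigma^k_i)$, and likewise the number of non-zero entries in row $i$ of $(\mathbb{M}_k^{Dual})^{-1}$ is at most $\binom{n+1}{k+1}A(\sigma^k_i)$.
   Context: Primal mesh: $K$ is a simplicial mesh in which every simplex is a face of some $n$-simplex; $\sigma^k$ denotes a $k$-simplex and $\sigma^k_1,\sigma^k_2,\dots$ enumerate the (oriented) $k$-simplices of $K$. Both matrices are square and indexed by the $k$-simplices of $K$. $|\cdot|$ denotes length, area or volume as appropriate. Whitney discrete Hodge star: for each vertex $\mathbf{v}_i$ of $K$, $\lambda_i$ is the continuous function linear on every simplex with $\lambda_i(\mathbf{v}_j)=\delta_{ij}$. For $\sigma^k=[\mathbf{v}_0,\dots,\mathbf{v}_k]$ the Whitney function is the piecewise-defined $k$-form $$\mathcal{W}_{\sigma^k}=k!\sum_{i=0}^k(-1)^i\lambda_i\, d\lambda_0\wedge\cdots\wedge\widehat{d\lambda_i}\wedge\cdots\wedge d\lambda_k .$$ For $n=3$ these are identified with: $\lambda_i$ for a vertex $\mathbf{v}_i$;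 $\lambda_i\nabla\lambda_j-\lambda_j\nabla\lambda_i$ for an edge $[\mathbf{v}_i,\mathbf{v}_j]$; $2(\lambda_i\nabla\lambda_j\times\nabla\lambda_k+\lambda_j\nabla\lambda_k\times\nabla\lambda_i+\lambda_k\nabla\lambda_i\times\nabla\lambda_j)$ for a face $[\mathbf{v}_i,\mathbf{v}_j,\mathbf{v}_k]$; and (up to orientation sign) the function equal to $1/|\sigma^3|$ on $\sigma^3$ and $0$ elsewhere for a tetrahedron $\sigma^3$. Then $(\mathbb{M}_k^{Whit})_{ij}=\int_K \mathcal{W}_{\sigma^k_i}\cdot\mathcal{W}_{\sigma^k_j}$ with the pointwise Euclidean inner product. Dual mesh ($n=3$): the dual mesh $\star K$ is obtained by taking the barycenters (or circumcenters) of the tetrahedra and connecting them according to adjacency in the usual manner. Each $\sigma^k$ has a dual $(3-k)$-cell $\star\sigma^k$: $\star\sigma^3$ is the center of the tetrahedron $\sigma^3$ (a dual vertex); $\star\sigma^2$ is the edge joining the centers of the two tetrahedra containing the face $\sigma^2$; $\star\sigma^1$ is the polygonal facet whose vertices are the centers of the tetrahedra containing the edge $\sigma^1$; $\star\sigma^0$ is the polyhedron whose vertices are the centers of the tetrahedra containing the vertex $\sigma^0$. Sibson coordinates: let $\mathcal{T}$ be a polyhedral cell of the dual mesh with vertex set $P=\{\mathbf{v}_1,\dots,\mathbf{v}_N\}$. For a point $\mathbf{p}$ of a point set $Q$ put $V_Q(\mathbf{p})=\{\mathbf{y}\in\mathcal{T}: |\mathbf{y}-\mathbf{p}|<|\mathbf{y}-\mathbf{q}|\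 \forall \mathbf{q}\in Q\setminus\{\mathbf{p}\}\}$. For $\mathbf{x}\in\mathcal{T}$ and $P'=P\cup\{\mathbf{x}\}$, set $D(\mathbf{x})=|V_{P'}(\mathbf{x})|$ and $$\overline\lambda_i(\mathbf{x})=\frac{|V_{P'}(\mathbf{x})\cap V_P(\mathbf{v}_i)|}{D(\mathbf{x})}.$$ For a dual vertex $\overline{\mathbf{v}}_i$, the function $\overline\lambda_i$ on the domain is given by this formula on each polyhedral dual cell having $\overline{\mathbf{v}}_i$ as a vertex, and is zero on the other dual cells; gradients are taken cell by cell. Dual Whitney functions: - Dual vertex $\star\sigma^3=\overline{\mathbf{v}}_i$: $\overline{\mathcal{W}}_{\star\sigma^3}=\overline\lambda_i$. - Oriented dual edge $\star\sigma^2=[\overline{\mathbf{v}}_i,\overline{\mathbf{v}}_j]$: $\overline{\mathcal{W}}_{\star\sigma^2}=\overline\lambda_i\nabla\overline\lambda_j-\overline\lambda_j\nabla\overline\lambda_i$. - Dual face $\star\sigma^1$ with vertices $\overline{\mathbf{v}}_0,\dots,\overline{\mathbf{v}}_{m-1}$: let $\overline{\mathbf{c}}$ be the centroid of these vertices and $\tau_i=[\overline{\mathbf{c}},\overline{\mathbf{v}}_i,\overline{\mathbf{v}}_{i+1}]$ (indices mod $m$). In each polyhedral dual cell having $\star\sigma^1$ as a facet, join $\tau_i$ to the endpoint of $\sigma^1$ inside that polyhedron to form a tetrahedron. Then $\overline{\mathcal{W}}_{\star\sigma^1}=\sum_{i=0}^{m-1}\frac{|\tau_i|}{|\star\sigma^1|}\mathcal{W}_{\tau_i}\chi_{\tau_i}$,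 where $\chi_{\tau_i}$ is the indicator function of the tetrahedra so formed on $\tau_i$ and, with $\lambda_{\overline{\mathbf{c}}},\lambda_i,\lambda_{i+1}$ the barycentric coordinates of such a tetrahedron for the vertices $\overline{\mathbf{c}},\overline{\mathbf{v}}_i,\overline{\mathbf{v}}_{i+1}$, $\mathcal{W}_{\tau_i}=2(\lambda_{\overline{\mathbf{c}}}\nabla\lambda_i\times\nabla\lambda_{i+1}-\lambda_i\nabla\lambda_{\overline{\mathbf{c}}}\times\nabla\lambda_{i+1}+\lambda_{i+1}\nabla\lambda_{\overline{\mathbf{c}}}\times\nabla\lambda_i)$. - Dual cell $\star\sigma^0$: $\overline{\mathcal{W}}_{\star\sigma^0}$ equals $1/|\star\sigma^0|$ on $\star\sigma^0$ and $0$ elsewhere. Dual discrete Hodge star: $((\mathbb{M}_k^{Dual})^{-1})_{ij}=(\overline{\mathcal{W}}_{\star\sigma_i^k},\overline{\mathcal{W}}_{\star\sigma_j^k})$, the integral over the dual domain $\star K$ of the pointwise (Euclidean) product; the notation $(\mathbb{M}_k^{Dual})^{-1}$ denotes the matrix so defined. *)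

theory Defs
  imports "HOL-Analysis.Analysis"
begin

section \<open>Simplicial meshes\<close>

definition ksimplices :: "'a::euclidean_space set set \<Rightarrow> nat \<Rightarrow> 'a set set" where
  "ksimplices K k = {S \<in> K. int k simplex S}"

definition verts :: "'a::euclidean_space set \<Rightarrow> 'a set" where
  "verts S = {v. v extreme_point_of S}"

text \<open>\<open>simplicial_complex\<close> includes finiteness of the complex. Complexes may contain the empty
  simplex; it is never a member of \<open>ksimplices K k\<close>.\<close>

definition simplicial_mesh :: "'a::euclidean_space set set \<Rightarrow> bool" where
  "simplicial_mesh K \<longleftrightarrow>
     simplicial_complex K \<and> (\<forall>S\<in>K. \<exists>T\<in>ksimplices K DIM('a). S face_of T)"

definition incident_number :: "'a::euclidean_space set set \<Rightarrow> 'a set \<Rightarrow> nat" where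
  "incident_number K S = card {T \<in> ksimplices K DIM('a). verts T \<inter> verts S \<noteq> {}}"

text \<open>An oriented simplex is represented by an ordering of its vertices.\<close>

definition vertex_ordering ::
    "'a::euclidean_space set set \<Rightarrow> nat \<Rightarrow> ('a set \<Rightarrow> 'a list) \<Rightarrow> bool" where
  "vertex_ordering K k vo \<longleftrightarrow>
     (\<forall>S\<in>ksimplices K k. distinct (vo S) \<and> set (vo S) = verts S)"


section \<open>Whitney discrete Hodge star\<close>

definition is_hat :: "'a::euclidean_space set set \<Rightarrow> 'a \<Rightarrow> ('a \<Rightarrow> real) \<Rightarrow> bool" where
  "is_hat K v f \<longleftrightarrow>
     continuous_on (\<Union>K) f \<and>
     (\<forall>S\<in>K. \<forall>x\<in>S. \<forall>y\<in>S. \<forall>t\<in>{0..1}.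
        f ((1 - t) *\<^sub>R x + t *\<^sub>R y) = (1 - t) * f x + t * f y) \<and>
     (\<forall>w. {w} \<in> K \<longrightarrow> f w = (if w = v then 1 else 0)) \<and>
     (\<forall>x. x \<notin> \<Union>K \<longrightarrow> f x = 0)"

text \<open>Well defined for every vertex of a simplicial complex, see \<open>ex1_is_hat\<close> below.\<close>

definition hat :: "'a::euclidean_space set set \<Rightarrow> 'a \<Rightarrow> 'a \<Rightarrow> real" where
  "hat K v = (THE f. is_hat K v f)"

text \<open>A \<open>k\<close>-covector is a function on lists of \<open>k\<close> vectors. The wedge product of 1-covectors is
  \<open>(a\<^sub>1 \<and> \<dots> \<and> a\<^sub>k)(w\<^sub>1, \<dots>, w\<^sub>k) = det (a\<^sub>i (w\<^sub>j))\<close>, written out by the Leibniz formula because \<open>k\<close> is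
  not a type. The Euclidean inner product sums over all \<open>k\<close>-tuples of basis vectors; division
  by \<open>k!\<close> makes this the sum over increasing tuples.\<close>

definition wedge :: "('a \<Rightarrow> real) list \<Rightarrow> 'a list \<Rightarrow> real" where
  "wedge as ws =
     (\<Sum>p | p permutes {..<length as}. of_int (sign p) * (\<Prod>i<length as. (as ! i) (ws ! p i)))"

definition form_inner ::
    "nat \<Rightarrow> ('a::euclidean_space list \<Rightarrow> real) \<Rightarrow> ('a list \<Rightarrow> real) \<Rightarrow> real" where
  "form_inner k a b = (\<Sum>ws | set ws \<subseteq> Basis \<and> length ws = k. a ws * b ws) / fact k"

text \<open>The derivatives exist off the frontiers of the top-dimensional simplices, hence almost
  everywhere on \<open>\<Union>K\<close>; there they are the derivatives taken simplex by simplex.\<close>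

definition whitney_form ::
    "'a::euclidean_space set set \<Rightarrow> 'a list \<Rightarrow> 'a \<Rightarrow> 'a list \<Rightarrow> real" where
  "whitney_form K vs x ws =
     (let k = length vs - 1 in
        fact k * (\<Sum>i\<le>k. (-1) ^ i * hat K (vs ! i) x *
          wedge (map (\<lambda>v. frechet_derivative (hat K v) (at x)) (take i vs @ drop (Suc i) vs)) ws))"

definition whitney_star ::
    "'a::euclidean_space set set \<Rightarrow> nat \<Rightarrow> ('a set \<Rightarrow> 'a list) \<Rightarrow> 'a set \<Rightarrow> 'a set \<Rightarrow> real" where
  "whitney_star K k vo S T =
     (LINT x:\<Union>K|lebesgue. form_inner k (whitney_form K (vo S) x) (whitney_form K (vo T) x))"


section \<open>Dual meshes in three dimensions\<close>

definition barycenter :: "(real^3) set \<Rightarrow> real^3" where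
  "barycenter T = (\<Sum>v\<in>verts T. v) /\<^sub>R real (card (verts T))"

definition circumcenter :: "(real^3) set \<Rightarrow> real^3" where
  "circumcenter T = (THE c. \<exists>r. \<forall>v\<in>verts T. dist c v = r)"

text \<open>\<open>fan e\<close> lists the tetrahedra around the edge \<open>e\<close>, neighbours sharing a face. It fixes the
  cyclic order, and the orientation, of the vertices of the dual facet of \<open>e\<close>.\<close>

definition edge_fans ::
    "(real^3) set set \<Rightarrow> ((real^3) set \<Rightarrow> (real^3) set list) \<Rightarrow> bool" where
  "edge_fans K fan \<longleftrightarrow>
     (\<forall>e\<in>ksimplices K 1.
        distinct (fan e) \<and>
        set (fan e) = {T \<in> ksimplices K 3. e face_of T} \<and>
        (\<forall>i. Suc i < length (fan e) \<longrightarrow> fan e ! i \<inter> fan e ! Suc i \<in> ksimplices K 2))"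

text \<open>\<open>dedge f\<close> is the oriented dual edge of the face \<open>f\<close>, given by the tetrahedra whose centers
  are its end points. For a face in the boundary both are the one tetrahedron containing \<open>f\<close>, and
  the dual edge degenerates to a point.\<close>

definition dual_edges ::
    "(real^3) set set \<Rightarrow> ((real^3) set \<Rightarrow> (real^3) set \<times> (real^3) set) \<Rightarrow> bool" where
  "dual_edges K dedge \<longleftrightarrow>
     (\<forall>f\<in>ksimplices K 2.
        {fst (dedge f), snd (dedge f)} = {T \<in> ksimplices K 3. f face_of T})"

text \<open>In the following \<open>ps\<close> lists the vertices of a dual facet. The facet is triangulated by the
  triangles \<open>[facet_center ps, ps ! i, ps ! next_idx ps i]\<close>.\<close>

definition facet_center :: "(real^3) list \<Rightarrow> real^3" where
  "facet_center ps = sum_list ps /\<^sub>R real (length ps)"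

definition next_idx :: "(real^3) list \<Rightarrow> nat \<Rightarrow> nat" where
  "next_idx ps i = Suc i mod length ps"

definition triangle_area :: "real^3 \<Rightarrow> real^3 \<Rightarrow> real^3 \<Rightarrow> real" where
  "triangle_area a b c = norm (cross3 (b - a) (c - a)) / 2"

text \<open>The facet need not be planar when barycenters are used, so its area is that of its
  triangulation.\<close>

definition facet_area :: "(real^3) list \<Rightarrow> real" where
  "facet_area ps =
     (\<Sum>i<length ps. triangle_area (facet_center ps) (ps ! i) (ps ! next_idx ps i))"

definition facet_tetra :: "real^3 \<Rightarrow> (real^3) list \<Rightarrow> nat \<Rightarrow> (real^3) set" where
  "facet_tetra v ps i = {v, facet_center ps, ps ! i, ps ! next_idx ps i}"

definition dual_facet ::
    "((real^3) set \<Rightarrow> real^3) \<Rightarrow> ((real^3) set \<Rightarrow> (real^3) set list) \<Rightarrow> (real^3) set \<Rightarrow>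
     (real^3) list" where
  "dual_facet ctr fan e = map ctr (fan e)"

text \<open>The polyhedral dual cell of the vertex \<open>v\<close> is the region enclosed by the dual facets of the
  edges at \<open>v\<close>, i.e. the union of the tetrahedra joining the triangles of these facets to \<open>v\<close>.
  If the facets are planar and bound a convex body containing \<open>v\<close>, this is the convex hull of
  \<open>dual_cell_verts\<close>. With barycenters the facets are in general not planar, and convex hulls would
  overlap. At a boundary vertex the cell is closed off by \<open>v\<close> itself.\<close>

definition dual_cell ::
    "(real^3) set set \<Rightarrow> ((real^3) set \<Rightarrow> real^3) \<Rightarrow> ((real^3) set \<Rightarrow> (real^3) set list) \<Rightarrow>
     real^3 \<Rightarrow> (real^3) set" where
  "dual_cell K ctr fan v =
     (\<Union>e\<in>{e \<in> ksimplices K 1. v \<in> verts e}. \<Union>i<length (fan e).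
        convex hull (facet_tetra v (dual_facet ctr fan e) i))"

definition dual_cell_verts ::
    "(real^3) set set \<Rightarrow> ((real^3) set \<Rightarrow> real^3) \<Rightarrow> real^3 \<Rightarrow> (real^3) set" where
  "dual_cell_verts K ctr v = ctr ` {T \<in> ksimplices K 3. v \<in> verts T}"

definition dual_domain ::
    "(real^3) set set \<Rightarrow> ((real^3) set \<Rightarrow> real^3) \<Rightarrow> ((real^3) set \<Rightarrow> (real^3) set list) \<Rightarrow>
     (real^3) set" where
  "dual_domain K ctr fan = (\<Union>v\<in>{v. {v} \<in> K}. dual_cell K ctr fan v)"

text \<open>The vertex whose dual cell contains \<open>x\<close>. The cells of a dual mesh meet only along their
  boundaries, so the choice matters only on a null set.\<close>

definition cell_at ::
    "(real^3) set set \<Rightarrow> ((real^3) set \<Rightarrow> real^3) \<Rightarrow> ((real^3) set \<Rightarrow> (real^3) set list) \<Rightarrow>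
     real^3 \<Rightarrow> real^3" where
  "cell_at K ctr fan x = (SOME v. {v} \<in> K \<and> x \<in> dual_cell K ctr fan v)"


section \<open>Sibson and barycentric coordinates\<close>

definition voronoi :: "'a::metric_space set \<Rightarrow> 'a set \<Rightarrow> 'a \<Rightarrow> 'a set" where
  "voronoi C Q p = {y \<in> C. \<forall>q\<in>Q - {p}. dist y p < dist y q}"

definition sibson :: "'a::euclidean_space set \<Rightarrow> 'a set \<Rightarrow> 'a \<Rightarrow> 'a \<Rightarrow> real" where
  "sibson C P p x =
     measure lebesgue (voronoi C (insert x P) x \<inter> voronoi C P p) /
     measure lebesgue (voronoi C (insert x P) x)"

definition barycentric :: "'a::euclidean_space set \<Rightarrow> 'a \<Rightarrow> 'a \<Rightarrow> real" where
  "barycentric V p x =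
     (THE t. \<exists>u. sum u V = 1 \<and> (\<Sum>w\<in>V. u w *\<^sub>R w) = x \<and> u p = t)"

definition grad :: "('a::real_inner \<Rightarrow> real) \<Rightarrow> 'a \<Rightarrow> 'a" where
  "grad f x = (THE g. GDERIV f x :> g)"

text \<open>Sibson coordinate of the dual vertex \<open>ctr T\<close>, as a function on the dual cell of \<open>v\<close>. The
  dual vertex belongs to that cell iff \<open>v\<close> is a vertex of \<open>T\<close>; comparing the points \<open>ctr T\<close>
  instead would identify dual vertices with coinciding circumcenters.\<close>

definition dual_coord ::
    "(real^3) set set \<Rightarrow> ((real^3) set \<Rightarrow> real^3) \<Rightarrow> ((real^3) set \<Rightarrow> (real^3) set list) \<Rightarrow>
     real^3 \<Rightarrow> (real^3) set \<Rightarrow> real^3 \<Rightarrow> real" where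
  "dual_coord K ctr fan v T x =
     (if v \<in> verts T then sibson (dual_cell K ctr fan v) (dual_cell_verts K ctr v) (ctr T) x
      else 0)"


section \<open>Dual Whitney functions and dual discrete Hodge star\<close>

text \<open>The number in a name is the dimension of the primal simplex. Each function is given cell by
  cell, with \<open>cell_at K ctr fan x\<close> selecting the cell.\<close>

definition dual_whitney3 ::
    "(real^3) set set \<Rightarrow> ((real^3) set \<Rightarrow> real^3) \<Rightarrow> ((real^3) set \<Rightarrow> (real^3) set list) \<Rightarrow>
     (real^3) set \<Rightarrow> real^3 \<Rightarrow> real" where
  "dual_whitney3 K ctr fan T x = dual_coord K ctr fan (cell_at K ctr fan x) T x"

definition dual_whitney2 ::
    "(real^3) set set \<Rightarrow> ((real^3) set \<Rightarrow> real^3) \<Rightarrow> ((real^3) set \<Rightarrow> (real^3) set list) \<Rightarrow>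
     ((real^3) set \<Rightarrow> (real^3) set \<times> (real^3) set) \<Rightarrow> (real^3) set \<Rightarrow> real^3 \<Rightarrow> real^3" where
  "dual_whitney2 K ctr fan dedge f x =
     (let v = cell_at K ctr fan x;
          l1 = dual_coord K ctr fan v (fst (dedge f));
          l2 = dual_coord K ctr fan v (snd (dedge f))
      in l1 x *\<^sub>R grad l2 x - l2 x *\<^sub>R grad l1 x)"

definition triangle_whitney :: "real^3 \<Rightarrow> (real^3) list \<Rightarrow> nat \<Rightarrow> real^3 \<Rightarrow> real^3" where
  "triangle_whitney v ps i x =
     (let l = barycentric (facet_tetra v ps i);
          c = facet_center ps; a = ps ! i; b = ps ! next_idx ps i
      in 2 *\<^sub>R (l c x *\<^sub>R cross3 (grad (l a) x) (grad (l b) x)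
              - l a x *\<^sub>R cross3 (grad (l c) x) (grad (l b) x)
              + l b x *\<^sub>R cross3 (grad (l c) x) (grad (l a) x)))"

definition dual_whitney1 ::
    "(real^3) set set \<Rightarrow> ((real^3) set \<Rightarrow> real^3) \<Rightarrow> ((real^3) set \<Rightarrow> (real^3) set list) \<Rightarrow>
     (real^3) set \<Rightarrow> real^3 \<Rightarrow> real^3" where
  "dual_whitney1 K ctr fan e x =
     (let v = cell_at K ctr fan x; ps = dual_facet ctr fan e
      in if v \<in> verts e then
           (\<Sum>i<length ps.
              (triangle_area (facet_center ps) (ps ! i) (ps ! next_idx ps i) / facet_area ps
                * indicator (convex hull (facet_tetra v ps i)) x) *\<^sub>R triangle_whitney v ps i x)
         else 0)"

definition dual_whitney0 ::
    "(real^3) set set \<Rightarrow> ((real^3) set \<Rightarrow> real^3) \<Rightarrow> ((real^3) set \<Rightarrow> (real^3) set list) \<Rightarrow>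
     (real^3) set \<Rightarrow> real^3 \<Rightarrow> real" where
  "dual_whitney0 K ctr fan s x =
     (let v = cell_at K ctr fan x
      in if s = {v} then 1 / measure lebesgue (dual_cell K ctr fan v) else 0)"

definition dual_product ::
    "(real^3) set set \<Rightarrow> ((real^3) set \<Rightarrow> real^3) \<Rightarrow> ((real^3) set \<Rightarrow> (real^3) set list) \<Rightarrow>
     ((real^3) set \<Rightarrow> (real^3) set \<times> (real^3) set) \<Rightarrow> nat \<Rightarrow> (real^3) set \<Rightarrow> (real^3) set \<Rightarrow>
     real^3 \<Rightarrow> real" where
  "dual_product K ctr fan dedge k S T x =
     (if k = 0 then dual_whitney0 K ctr fan S x * dual_whitney0 K ctr fan T x
      else if k = 1 then dual_whitney1 K ctr fan S x \<bullet> dual_whitney1 K ctr fan T x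
      else if k = 2 then dual_whitney2 K ctr fan dedge S x \<bullet> dual_whitney2 K ctr fan dedge T x
      else dual_whitney3 K ctr fan S x * dual_whitney3 K ctr fan T x)"

text \<open>The matrix denoted by the inverse of the dual star, for \<open>k \<le> 3\<close>.\<close>

definition dual_star_inv ::
    "(real^3) set set \<Rightarrow> ((real^3) set \<Rightarrow> real^3) \<Rightarrow> ((real^3) set \<Rightarrow> (real^3) set list) \<Rightarrow>
     ((real^3) set \<Rightarrow> (real^3) set \<times> (real^3) set) \<Rightarrow> nat \<Rightarrow> (real^3) set \<Rightarrow> (real^3) set \<Rightarrow>
     real" where
  "dual_star_inv K ctr fan dedge k S T =
     (LINT x:dual_domain K ctr fan|lebesgue. dual_product K ctr fan dedge k S T x)"


section \<open>Existence and uniqueness of the hat functions\<close>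

lemma segment_affine_sum:
  fixes f :: "'a::euclidean_space \<Rightarrow> real"
  assumes "convex S"
    and f: "\<And>x y t. x \<in> S \<Longrightarrow> y \<in> S \<Longrightarrow> t \<in> {0..1} \<Longrightarrow>
              f ((1 - t) *\<^sub>R x + t *\<^sub>R y) = (1 - t) * f x + t * f y"
    and "finite C" "C \<subseteq> S" "\<And>w. w \<in> C \<Longrightarrow> 0 \<le> u w" "sum u C = 1"
  shows "f (\<Sum>w\<in>C. u w *\<^sub>R w) = (\<Sum>w\<in>C. u w * f w)"
proof (rule antisym)
  have "C \<noteq> {}" using assms(6) by auto
  have 1: "convex_on S f"
    using assms(1) f by (intro convex_onI) (auto simp: f)
  have 2: "convex_on S (\<lambda>x. - f x)"
    using assms(1) f by (intro convex_onI) (auto simp: f)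
  show "f (\<Sum>w\<in>C. u w *\<^sub>R w) \<le> (\<Sum>w\<in>C. u w * f w)"
    using convex_on_sum[OF \<open>finite C\<close> \<open>C \<noteq> {}\<close> 1 assms(6), of "\<lambda>x. x"] assms(4,5) by auto
  have "- f (\<Sum>w\<in>C. u w *\<^sub>R w) \<le> (\<Sum>w\<in>C. u w * - f w)"
    using convex_on_sum[OF \<open>finite C\<close> \<open>C \<noteq> {}\<close> 2 assms(6), of "\<lambda>x. x"] assms(4,5) by auto
  then show "(\<Sum>w\<in>C. u w * f w) \<le> f (\<Sum>w\<in>C. u w *\<^sub>R w)"
    by (simp add: sum_negf)
qed

lemma simplex_segment_affine_eq:
  fixes f g :: "'a::euclidean_space \<Rightarrow> real"
  assumes "n simplex S"
    and f: "\<And>x y t. x \<in> S \<Longrightarrow> y \<in> S \<Longrightarrow> t \<in> {0..1} \<Longrightarrow>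
              f ((1 - t) *\<^sub>R x + t *\<^sub>R y) = (1 - t) * f x + t * f y"
    and g: "\<And>x y t. x \<in> S \<Longrightarrow> y \<in> S \<Longrightarrow> t \<in> {0..1} \<Longrightarrow>
              g ((1 - t) *\<^sub>R x + t *\<^sub>R y) = (1 - t) * g x + t * g y"
    and eq: "\<And>w. w extreme_point_of S \<Longrightarrow> f w = g w"
    and "x \<in> S"
  shows "f x = g x"
proof -
  obtain C where C: "finite C" "\<not> affine_dependent C" "S = convex hull C"
    using assms(1) by (auto simp: simplex)
  have sub: "C \<subseteq> S" using C hull_subset by metis
  obtain u where u: "\<And>w. w \<in> C \<Longrightarrow> 0 \<le> u w" "sum u C = 1" "(\<Sum>w\<in>C. u w *\<^sub>R w) = x"
    using \<open>x \<in> S\<close> C by (auto simp: convex_hull_finite)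
  have conv: "convex S" using C by simp
  have "w extreme_point_of S" if "w \<in> C" for w
    using extreme_point_of_convex_hull_affine_independent[of C w] C that by simp
  then have "(\<Sum>w\<in>C. u w * f w) = (\<Sum>w\<in>C. u w * g w)"
    using eq by (auto intro!: sum.cong)
  then show ?thesis
    using segment_affine_sum[OF conv f C(1) sub u(1,2)]
      segment_affine_sum[OF conv g C(1) sub u(1,2)] u(3) by simp
qed

lemma affine_independent_interpolate:
  fixes b :: "'a::euclidean_space \<Rightarrow> real"
  assumes "\<not> affine_dependent C"
  obtains g c where "linear g" "\<And>w. w \<in> C \<Longrightarrow> g w + c = b w"
proof (cases "C = {}")
  case True
  then show ?thesis using that[of "\<lambda>_. 0" 0] by (auto simp: linear_iff)
next
  case False
  then obtain a where a: "a \<in> C" by auto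
  let ?B = "(\<lambda>x. - a + x) ` (C - {a})"
  have "independent ?B"
    using assms a affine_dependent_iff_dependent2 by blast
  then obtain g where g: "linear g" "\<forall>x\<in>?B. g x = b (x + a) - b a"
    using linear_independent_extend[of ?B "\<lambda>x. b (x + a) - b a"] by blast
  have "g w + (b a - g a) = b w" if "w \<in> C" for w
  proof (cases "w = a")
    case False
    then have "g (- a + w) = b w - b a" using g(2) that False by auto
    moreover have "g (w - a) = g w - g a" using g(1) by (rule linear_diff)
    ultimately show ?thesis by simp
  qed simp
  then show ?thesis using that g(1) by blast
qed

lemma ex1_is_hat:
  assumes K: "simplicial_complex K" and "{v} \<in> K"
  shows "\<exists>!f. is_hat K v f"
proof -
  let ?d = "\<lambda>w. if w = v then 1 else (0::real)"
  have fin: "finite K" and spx: "\<And>S. S \<in> K \<Longrightarrow> \<exists>n. n simplex S"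
    and face: "\<And>F S. S \<in> K \<Longrightarrow> F face_of S \<Longrightarrow> F \<in> K"
    and int: "\<And>S S'. S \<in> K \<Longrightarrow> S' \<in> K \<Longrightarrow> (S \<inter> S') face_of S"
    using K by (auto simp: simplicial_complex_def)
  have ext: "{w} \<in> K" if "S \<in> K" "w extreme_point_of S" for S w
    using face[OF that(1)] that(2) by (simp add: face_of_singleton)
  have "\<exists>g c. linear g \<and> (\<forall>w. w extreme_point_of S \<longrightarrow> g w + c = ?d w)" if "S \<in> K" for S
  proof -
    obtain C where C: "\<not> affine_dependent C" "S = convex hull C"
      using spx[OF \<open>S \<in> K\<close>] by (auto simp: simplex_def)
    obtain g c where "linear g" "\<And>w. w \<in> C \<Longrightarrow> g w + c = ?d w"
      using affine_independent_interpolate[OF C(1), of ?d] by blast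
    moreover have "w \<in> C" if "w extreme_point_of S" for w
      using C extreme_point_of_convex_hull_affine_independent[of C] that by simp
    ultimately show ?thesis by blast
  qed
  then obtain g c where lin: "\<And>S. S \<in> K \<Longrightarrow> linear (g S)"
    and gc: "\<And>S w. S \<in> K \<Longrightarrow> w extreme_point_of S \<Longrightarrow> g S w + c S = ?d w"
    by metis
  define h where "h = (\<lambda>S x. g S x + c S)"
  have seg: "h S ((1 - t) *\<^sub>R x + t *\<^sub>R y) = (1 - t) * h S x + t * h S y" if "S \<in> K" for S x y t
    unfolding h_def linear_add[OF lin[OF that]] linear_scale[OF lin[OF that]]
    by (simp add: algebra_simps)
  have agree: "h S x = h S' x" if "S \<in> K" "S' \<in> K" "x \<in> S" "x \<in> S'" for S S' x
  proof -
    have F: "(S \<inter> S') face_of S" "(S \<inter> S') face_of S'"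
      using int[OF that(1,2)] int[OF that(2,1)] by (auto simp: Int_commute)
    then obtain n where n: "n simplex (S \<inter> S')"
      using spx face \<open>S \<in> K\<close> by blast
    show ?thesis
    proof (rule simplex_segment_affine_eq[OF n, of "h S" "h S'"])
      fix w assume "w extreme_point_of (S \<inter> S')"
      then have "w extreme_point_of S" "w extreme_point_of S'"
        using extreme_point_of_face[OF F(1)] extreme_point_of_face[OF F(2)] by auto
      then show "h S w = h S' w"
        using gc that by (simp add: h_def)
    qed (auto intro: seg that)
  qed
  define f where
    "f = (\<lambda>x. if x \<in> \<Union>K then h (SOME S. S \<in> K \<and> x \<in> S) x else 0)"
  have fh: "f x = h S x" if "S \<in> K" "x \<in> S" for S x
  proof -
    define S' where "S' = (SOME S. S \<in> K \<and> x \<in> S)"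
    have "S' \<in> K \<and> x \<in> S'"
      unfolding S'_def using that by (intro someI[of "\<lambda>S. S \<in> K \<and> x \<in> S"]) auto
    then have "h S' x = h S x" using agree[of S' S x] that by blast
    moreover have "f x = h S' x" using that unfolding f_def S'_def by auto
    ultimately show ?thesis by simp
  qed
  have "is_hat K v f"
    unfolding is_hat_def
  proof (intro conjI ballI allI impI)
    have "continuous_on (\<Union>S\<in>K. S) f"
    proof (rule continuous_on_closed_Union[OF fin])
      show "closed S" if "S \<in> K" for S
        using spx[OF that] by (auto intro: closed_simplex)
      have "continuous_on S (h S)" if "S \<in> K" for S
        using lin[OF that] unfolding h_def
        by (intro continuous_on_add continuous_on_const linear_continuous_on)
          (simp add: linear_conv_bounded_linear)
      then show "continuous_on S f" if "S \<in> K" for S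
        using fh[OF that] that by (subst continuous_on_cong[OF refl, of S f "h S"]) auto
    qed
    then show "continuous_on (\<Union>K) f" by simp
  next
    fix S x y and t :: real
    assume a: "S \<in> K" "x \<in> S" "y \<in> S" "t \<in> {0..1}"
    have "convex S" using spx[OF a(1)] by (auto intro: convex_simplex)
    then have "(1 - t) *\<^sub>R x + t *\<^sub>R y \<in> S"
      using a by (auto simp: convex_alt)
    then show "f ((1 - t) *\<^sub>R x + t *\<^sub>R y) = (1 - t) * f x + t * f y"
      using fh[OF a(1)] a seg[OF a(1)] by metis
  next
    fix w assume "{w} \<in> K"
    then show "f w = ?d w" using fh[of "{w}" w] gc[of "{w}" w] by (simp add: h_def)
  next
    fix x assume "x \<notin> \<Union>K"
    then show "f x = 0" by (simp add: f_def)
  qed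
  moreover have "f1 = f2" if "is_hat K v f1" "is_hat K v f2" for f1 f2
  proof
    fix x
    show "f1 x = f2 x"
    proof (cases "x \<in> \<Union>K")
      case True
      then obtain S n where S: "S \<in> K" "x \<in> S" "n simplex S" using spx by blast
      show ?thesis
        by (rule simplex_segment_affine_eq[OF S(3) _ _ _ S(2)])
          (use that S ext in \<open>auto simp: is_hat_def\<close>)
    qed (use that in \<open>auto simp: is_hat_def\<close>)
  qed
  ultimately show ?thesis by blast
qed

end

(*
  Every Whitney function, primal or dual, is supported on the cells that touch its simplex. Hence a
  non-zero entry in row S and column T forces T to be a face of some n-simplex R incident on a
  vertex of S, and every such R has only (n + 1 choose k + 1) faces of dimension k.
*)
theory Submission
  imports Defs
begin

section \<open>Simplices as vertex sets\<close>

text \<open>The extreme points of a simplex are exactly the affinely independent points that span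
  it. This turns questions about simplices into counting of finite vertex sets.\<close>

lemma ksimplices_convex_hull_verts:
  assumes "T \<in> ksimplices K k"
  shows "T = convex hull (verts T)" and "finite (verts T)" and "card (verts T) = k + 1"
proof -
  obtain C where C: "\<not> affine_dependent C" "int (card C) = int k + 1" "T = convex hull C"
    using assms by (auto simp: ksimplices_def simplex_def)
  then have "verts T = C"
    using extreme_point_of_convex_hull_affine_independent[of C] by (auto simp: verts_def)
  then show "T = convex hull (verts T)" "finite (verts T)" "card (verts T) = k + 1"
    using C aff_independent_finite by auto
qed

lemma verts_ksimplices_nonempty:
  assumes "T \<in> ksimplices K k"
  shows "verts T \<noteq> {}"
  using ksimplices_convex_hull_verts(3)[OF assms] by auto

lemma inj_on_verts_ksimplices: "inj_on verts (ksimplices K k)"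
  by (metis inj_onI ksimplices_convex_hull_verts(1))

lemma verts_face_of_subset:
  assumes "F face_of T"
  shows "verts F \<subseteq> verts T"
  using extreme_point_of_face[OF assms] by (auto simp: verts_def)

lemma finite_ksimplices:
  assumes "simplicial_mesh K"
  shows "finite (ksimplices K k)"
  using assms by (simp add: simplicial_mesh_def simplicial_complex_def ksimplices_def)

text \<open>An extreme point is a face, and a complex is closed under faces. This provides the
  condition under which \<open>hat K v\<close> is well defined.\<close>

lemma singleton_verts_in_mesh:
  assumes "simplicial_mesh K" "S \<in> ksimplices K k" "v \<in> verts S"
  shows "{v} \<in> K"
  using assms unfolding simplicial_mesh_def simplicial_complex_def ksimplices_def verts_def
  by (metis (mono_tags, lifting) face_of_singleton mem_Collect_eq)

lemma ksimplices_face_of_top: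
  fixes K :: "'a::euclidean_space set set"
  assumes "simplicial_mesh K" "S \<in> ksimplices K k"
  obtains R where "R \<in> ksimplices K DIM('a)" "S face_of R"
  using assms by (auto simp: simplicial_mesh_def ksimplices_def)

text \<open>Since \<open>verts\<close> is injective on \<open>k\<close>-simplices, it suffices to
  count vertex sets. Each is a \<open>(k + 1)\<close>-subset of the vertices of some top simplex
  incident on \<open>S\<close>, so a union bound over these simplices gives the product.\<close>

lemma card_faces_of_incident_simplices_le:
  fixes K :: "'a::euclidean_space set set"
  assumes mesh: "simplicial_mesh K"
    and sub: "\<And>T. T \<in> \<T> \<Longrightarrow> T \<in> ksimplices K k \<and>
      (\<exists>R\<in>ksimplices K DIM('a). verts R \<inter> verts S \<noteq> {} \<and> verts T \<subseteq> verts R)"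
  shows "card \<T> \<le> ((DIM('a) + 1) choose (k + 1)) * incident_number K S"
proof -
  define \<R> where "\<R> = {R \<in> ksimplices K DIM('a). verts R \<inter> verts S \<noteq> {}}"
  define F where "F = (\<lambda>R :: 'a set. {A. A \<subseteq> verts R \<and> card A = k + 1})"
  have fin: "finite \<R>" "finite (F R)" "card (F R) = (DIM('a) + 1) choose (k + 1)"
    if "R \<in> \<R>" for R
    using finite_ksimplices[OF mesh] ksimplices_convex_hull_verts[of R K "DIM('a)"] that
      n_subsets[of "verts R" "k + 1"]
    by (auto simp: \<R>_def F_def)
  have "finite \<R>"
    using finite_ksimplices[OF mesh] by (simp add: \<R>_def)
  have "verts ` \<T> \<subseteq> (\<Union>R\<in>\<R>. F R)"
    using sub ksimplices_convex_hull_verts(3) by (fastforce simp: \<R>_def F_def)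
  moreover have "inj_on verts \<T>"
    using inj_on_subset[OF inj_on_verts_ksimplices[of K k]] sub by blast
  ultimately have "card \<T> \<le> card (\<Union>R\<in>\<R>. F R)"
    using fin(2) \<open>finite \<R>\<close> by (metis card_image card_mono finite_UN_I)
  also have "\<dots> \<le> (\<Sum>R\<in>\<R>. card (F R))"
    by (rule card_UN_le[OF \<open>finite \<R>\<close>])
  also have "\<dots> = ((DIM('a) + 1) choose (k + 1)) * card \<R>"
    using fin(3) by simp
  finally show ?thesis
    by (simp add: incident_number_def \<R>_def)
qed

section \<open>Support of the primal Whitney forms\<close>

text \<open>On \<open>R\<close> the hat function is affine along segments and vanishes at every
  vertex of \<open>R\<close>, so it agrees there with the zero function.\<close>

lemma hat_eq_0:
  assumes "simplicial_mesh K" "{v} \<in> K" "R \<in> ksimplices K n" "v \<notin> verts R" "x \<in> R"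
  shows "hat K v x = 0"
proof -
  have "\<exists>!f. is_hat K v f"
    using assms(1,2) by (intro ex1_is_hat) (simp_all add: simplicial_mesh_def)
  then have hat: "is_hat K v (hat K v)"
    unfolding hat_def by (rule theI')
  have R: "R \<in> K" "int n simplex R"
    using assms(3) by (auto simp: ksimplices_def)
  have "hat K v w = 0" if "w extreme_point_of R" for w
  proof -
    have "w \<in> verts R" using that by (simp add: verts_def)
    then show ?thesis
      using singleton_verts_in_mesh[OF assms(1,3)] assms(4) hat by (auto simp: is_hat_def)
  qed
  moreover have "hat K v ((1 - t) *\<^sub>R y + t *\<^sub>R z) = (1 - t) * hat K v y + t * hat K v z"
    if "y \<in> R" "z \<in> R" "t \<in> {0..1}" for y z t
    using hat R(1) that unfolding is_hat_def by blast
  ultimately show ?thesis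
    using simplex_segment_affine_eq[OF R(2), of "hat K v" "\<lambda>_. 0" x] assms(5) by simp
qed

text \<open>A zero covector is a zero row of the determinant: every Leibniz product contains a
  factor from it.\<close>

lemma wedge_eq_0:
  assumes "(\<lambda>_. 0) \<in> set as"
  shows "wedge as ws = 0"
proof -
  obtain j where "j < length as" "as ! j = (\<lambda>_. 0)"
    using assms by (metis in_set_conv_nth)
  then have prod: "(\<Prod>i<length as. (as ! i) (ws ! p i)) = 0" for p
    by (intro prod_zero) (auto intro: bexI[of _ j])
  show ?thesis by (simp only: wedge_def prod mult_zero_right sum.neutral_const)
qed

text \<open>Each summand contains the hat function of \<open>v\<close> either undifferentiated or as
  a differential inside the wedge. Both vanish at an interior point of \<open>R\<close>, because the
  hat function is zero on a whole neighbourhood.\<close>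

lemma whitney_form_eq_0:
  assumes "simplicial_mesh K" "{v} \<in> K" "v \<in> set vs"
    and "R \<in> ksimplices K n" "v \<notin> verts R" "x \<in> interior R"
  shows "whitney_form K vs x ws = 0"
proof -
  have zero: "hat K v y = 0" if "y \<in> interior R" for y
    using hat_eq_0[OF assms(1,2,4,5)] that interior_subset by blast
  have "(hat K v has_derivative (\<lambda>_. 0)) (at x)"
    by (rule has_derivative_transform_within_open[where f = "\<lambda>_. 0" and s = "interior R"])
      (use assms(6) zero in auto)
  then have deriv: "frechet_derivative (hat K v) (at x) = (\<lambda>_. 0)"
    by (metis frechet_derivative_at)
  obtain j where j: "j < length vs" "v = vs ! j"
    using assms(3) by (metis in_set_conv_nth)
  have summand: "hat K (vs ! i) x *
      wedge (map (\<lambda>v. frechet_derivative (hat K v) (at x)) (take i vs @ drop (Suc i) vs)) ws = 0"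
    for i
  proof (cases "i = j")
    case True
    then show ?thesis using zero[OF assms(6)] j by simp
  next
    case False
    have "v \<in> set (take i vs @ drop (Suc i) vs)"
    proof (cases "j < i")
      case True
      then show ?thesis using j by (auto simp: in_set_conv_nth)
    next
      case False
      \<comment> \<open>Here \<open>j > i\<close>, so \<open>v\<close> survives the omission of
        entry \<open>i\<close> and sits in the tail, shifted by \<open>Suc i\<close>.\<close>
      then have "drop (Suc i) vs ! (j - Suc i) = v" "j - Suc i < length (drop (Suc i) vs)"
        using \<open>i \<noteq> j\<close> j by auto
      then show ?thesis by (metis Un_iff nth_mem set_append)
    qed
    then show ?thesis
      by (subst wedge_eq_0) (use deriv in \<open>auto simp: image_iff intro!: bexI[of _ v]\<close>)
  qed
  show ?thesis
    by (simp only: whitney_form_def Let_def mult.assoc summand mult_zero_right sum.neutral_const)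
qed

lemma whitney_star_nonzero_imp:
  fixes K :: "'a::euclidean_space set set"
  assumes mesh: "simplicial_mesh K" and vo: "vertex_ordering K k vo"
    and S: "S \<in> ksimplices K k" and T: "T \<in> ksimplices K k"
    and nonzero: "whitney_star K k vo S T \<noteq> 0"
  shows "\<exists>R\<in>ksimplices K DIM('a). verts S \<subseteq> verts R \<and> verts T \<subseteq> verts R"
proof (rule ccontr)
  assume no: "\<not> ?thesis"
  \<comment> \<open>The exceptional set where a point need not be interior to a top simplex.
    Frontiers of convex sets are negligible, and there are finitely many of them.\<close>
  define N where "N = (\<Union>R\<in>ksimplices K DIM('a). frontier R)"
  have "negligible (frontier R)" if "R \<in> ksimplices K DIM('a)" for R
    using ksimplices_convex_hull_verts(1)[OF that]
    by (metis convex_convex_hull negligible_convex_frontier)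
  then have "negligible N"
    unfolding N_def using finite_ksimplices[OF mesh] by (intro negligible_Union) auto
  have "form_inner k (whitney_form K (vo S) x) (whitney_form K (vo T) x) = 0"
    if x: "x \<in> \<Union>K" "x \<notin> N" for x
  proof -
    obtain Q where "Q \<in> K" "x \<in> Q" using x(1) by blast
    then obtain R where R: "R \<in> ksimplices K DIM('a)" "x \<in> R"
      using mesh face_of_imp_subset unfolding simplicial_mesh_def by (meson subsetD)
    then have int: "x \<in> interior R"
      using x(2) closure_subset[of R] by (auto simp: N_def frontier_def)
    have "\<forall>ws. whitney_form K (vo U) x ws = 0"
      if "U \<in> ksimplices K k" "\<not> verts U \<subseteq> verts R" for U
    proof -
      obtain v where "v \<in> verts U" "v \<notin> verts R" using \<open>\<not> verts U \<subseteq> verts R\<close> by blast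
      moreover have "set (vo U) = verts U"
        using vo that(1) by (simp add: vertex_ordering_def)
      ultimately show ?thesis
        using whitney_form_eq_0[OF mesh _ _ R(1) _ int] singleton_verts_in_mesh[OF mesh that(1)]
        by blast
    qed
    \<comment> \<open>By the contrary assumption \<open>R\<close> misses a vertex of
      \<open>S\<close> or of \<open>T\<close>, which kills the corresponding form at
      \<open>x\<close>.\<close>
    then have "(\<forall>ws. whitney_form K (vo S) x ws = 0) \<or> (\<forall>ws. whitney_form K (vo T) x ws = 0)"
      using no R(1) S T by blast
    then show ?thesis
      by (auto simp: form_inner_def)
  qed
  then have "AE x in lebesgue. indicator (\<Union>K) x *\<^sub>R
      form_inner k (whitney_form K (vo S) x) (whitney_form K (vo T) x) = 0"
    using \<open>negligible N\<close>
    by (intro AE_I'[of N]) (auto simp: negligible_iff_null_sets indicator_def)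
  then have "whitney_star K k vo S T = 0"
    unfolding whitney_star_def set_lebesgue_integral_def by (rule integral_eq_zero_AE)
  then show False using nonzero by simp
qed

section \<open>Support of the dual Whitney functions\<close>

text \<open>As \<open>grad\<close> is a definite description, its value requires uniqueness: a
  vector orthogonal to every \<open>h\<close>, in particular to itself, is zero.\<close>

lemma grad_zero: "grad (\<lambda>_. 0) x = 0"
proof -
  have "g = 0" if "GDERIV (\<lambda>_. 0) x :> g" for g
  proof -
    have "(\<lambda>h. h \<bullet> g) = (\<lambda>_. 0)"
      using that has_derivative_const unfolding gderiv_def by (rule has_derivative_unique)
    then show ?thesis by (metis inner_eq_zero_iff)
  qed
  then show ?thesis
    unfolding grad_def by (blast intro: GDERIV_const)
qed

text \<open>Otherwise \<open>v\<close> together with the \<open>k + 1\<close> vertices of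
  \<open>F\<close> would exhaust the \<open>k + 2\<close> vertices of both \<open>A\<close> and
  \<open>B\<close>, forcing \<open>A = B\<close>.\<close>

lemma mem_verts_of_common_face:
  assumes "A \<in> ksimplices K (Suc k)" "B \<in> ksimplices K (Suc k)" "A \<noteq> B"
    and "F \<in> ksimplices K k" "F face_of A" "F face_of B"
    and "v \<in> verts A" "v \<in> verts B"
  shows "v \<in> verts F"
proof (rule ccontr)
  assume "v \<notin> verts F"
  then have "card (insert v (verts F)) = Suc k + 1"
    using ksimplices_convex_hull_verts(2,3)[OF assms(4)] by simp
  then have "insert v (verts F) = verts C"
    if "C \<in> ksimplices K (Suc k)" "F face_of C" "v \<in> verts C" for C
    using ksimplices_convex_hull_verts(2,3)[OF that(1)] verts_face_of_subset[OF that(2)] that(3)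
    by (intro card_subset_eq) auto
  then have "verts A = verts B" using assms by metis
  then show False
    using assms(1-3) inj_on_verts_ksimplices by (auto dest: inj_onD)
qed

lemma dual_whitney2_nonzero_imp:
  assumes "dual_edges K dedge" "f \<in> ksimplices K 2"
    and nonzero: "dual_whitney2 K ctr fan dedge f x \<noteq> 0"
  shows "cell_at K ctr fan x \<in> verts f"
proof -
  let ?v = "cell_at K ctr fan x"
  have tetra: "T \<in> ksimplices K 3 \<and> f face_of T" if "T \<in> {fst (dedge f), snd (dedge f)}" for T
    using assms(1,2) that unfolding dual_edges_def by blast
  have coord: "dual_coord K ctr fan v T = (\<lambda>_. 0)" if "v \<notin> verts T" for v T
    using that by (auto simp: dual_coord_def)
  \<comment> \<open>If one coordinate is identically zero on the cell, so is its gradient, and both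
    terms of the edge function vanish.\<close>
  have "?v \<in> verts T" if "T \<in> {fst (dedge f), snd (dedge f)}" for T
  proof (rule ccontr)
    assume "?v \<notin> verts T"
    then show False
      using nonzero that coord[of ?v T] by (auto simp: dual_whitney2_def Let_def grad_zero)
  qed
  \<comment> \<open>For a boundary face both end points come from the same tetrahedron and the two
    terms cancel.\<close>
  moreover have "fst (dedge f) \<noteq> snd (dedge f)"
    using nonzero by (auto simp: dual_whitney2_def Let_def)
  ultimately show ?thesis
    using mem_verts_of_common_face[of "fst (dedge f)" K 2 "snd (dedge f)" f] tetra assms(2)
    by (simp add: numeral_3_eq_3 numeral_2_eq_2)
qed

text \<open>Both factors are evaluated in the same cell. Whichever vertex \<open>cell_at\<close>
  selects, a non-zero factor forces it to be a vertex of the simplex concerned, so it is common to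
  \<open>S\<close> and \<open>T\<close>.\<close>

lemma dual_product_nonzero_imp:
  assumes "k \<le> 3" "dual_edges K dedge" "S \<in> ksimplices K k" "T \<in> ksimplices K k"
    and nonzero: "dual_product K ctr fan dedge k S T x \<noteq> 0"
  shows "verts S \<inter> verts T \<noteq> {}"
proof -
  consider "k = 0" | "k = 1" | "k = 2" | "k = 3" using assms(1) by linarith
  then show ?thesis
  proof cases
    case 1
    then have "S = T"
      using nonzero by (auto simp: dual_product_def dual_whitney0_def Let_def split: if_splits)
    then show ?thesis using verts_ksimplices_nonempty[OF assms(3)] by simp
  next
    case 2
    then show ?thesis
      using nonzero by (auto simp: dual_product_def dual_whitney1_def Let_def split: if_splits)
  next
    case 3
    then have "dual_whitney2 K ctr fan dedge S x \<noteq> 0" "dual_whitney2 K ctr fan dedge T x \<noteq> 0"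
      using nonzero by (auto simp: dual_product_def)
    then show ?thesis
      using dual_whitney2_nonzero_imp[OF assms(2)] assms(3,4) 3 by blast
  next
    case 4
    then show ?thesis
      using nonzero
      by (auto simp: dual_product_def dual_whitney3_def dual_coord_def split: if_splits)
  qed
qed

lemma dual_star_inv_nonzero_imp:
  assumes "k \<le> 3" "dual_edges K dedge" "S \<in> ksimplices K k" "T \<in> ksimplices K k"
    and "dual_star_inv K ctr fan dedge k S T \<noteq> 0"
  shows "verts S \<inter> verts T \<noteq> {}"
proof -
  have "\<exists>x. dual_product K ctr fan dedge k S T x \<noteq> 0"
  proof (rule ccontr)
    assume "\<not> ?thesis"
    then show False
      using assms(5) by (simp add: dual_star_inv_def set_lebesgue_integral_def)
  qed
  then show ?thesis
    using dual_product_nonzero_imp[OF assms(1-4)] by blast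
qed

section \<open>Counting the non-zero entries of a row\<close>

theorem corollary1:
  "(\<forall>(K :: (real^'n) set set) k vo S.
      simplicial_mesh K \<and> k \<le> CARD('n) \<and> vertex_ordering K k vo \<and> S \<in> ksimplices K k \<longrightarrow>
      card {T \<in> ksimplices K k. whitney_star K k vo S T \<noteq> 0}
        \<le> ((CARD('n) + 1) choose (k + 1)) * incident_number K S)
   \<and>
   (\<forall>(K :: (real^3) set set) k ctr fan dedge S.
      simplicial_mesh K \<and> k \<le> 3 \<and> (ctr = barycenter \<or> ctr = circumcenter) \<and>
      edge_fans K fan \<and> dual_edges K dedge \<and> S \<in> ksimplices K k \<longrightarrow>
      card {T \<in> ksimplices K k. dual_star_inv K ctr fan dedge k S T \<noteq> 0}
        \<le> ((3 + 1) choose (k + 1)) * incident_number K S)"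
proof (intro conjI allI impI, goal_cases)
  case (1 K k vo S)
  have "card {T \<in> ksimplices K k. whitney_star K k vo S T \<noteq> 0}
      \<le> ((DIM(real^'n) + 1) choose (k + 1)) * incident_number K S"
  proof (rule card_faces_of_incident_simplices_le, use 1 in blast)
    fix T assume "T \<in> {T \<in> ksimplices K k. whitney_star K k vo S T \<noteq> 0}"
    \<comment> \<open>The top simplex \<open>R\<close> contains all vertices of \<open>S\<close>,
      and there is at least one, so \<open>R\<close> is incident on \<open>S\<close>.\<close>
    then show "T \<in> ksimplices K k \<and> (\<exists>R\<in>ksimplices K DIM(real^'n).
        verts R \<inter> verts S \<noteq> {} \<and> verts T \<subseteq> verts R)"
      using whitney_star_nonzero_imp[of K k vo S T] verts_ksimplices_nonempty[of S K k] 1 by blast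
  qed
  then show ?case by simp
next
  case (2 K k ctr fan dedge S)
  have "card {T \<in> ksimplices K k. dual_star_inv K ctr fan dedge k S T \<noteq> 0}
      \<le> ((DIM(real^3) + 1) choose (k + 1)) * incident_number K S"
  proof (rule card_faces_of_incident_simplices_le, use 2 in blast)
    fix T assume "T \<in> {T \<in> ksimplices K k. dual_star_inv K ctr fan dedge k S T \<noteq> 0}"
    then have T: "T \<in> ksimplices K k" "verts S \<inter> verts T \<noteq> {}"
      using dual_star_inv_nonzero_imp[of k K dedge S T ctr fan] 2 by auto
    \<comment> \<open>Any top simplex having \<open>T\<close> as a face serves: the vertex shared by
      \<open>S\<close> and \<open>T\<close> makes it incident on \<open>S\<close>.\<close>
    obtain R where "R \<in> ksimplices K DIM(real^3)" "T face_of R"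
      using ksimplices_face_of_top[OF _ T(1)] 2 by blast
    then show "T \<in> ksimplices K k \<and> (\<exists>R\<in>ksimplices K DIM(real^3).
        verts R \<inter> verts S \<noteq> {} \<and> verts T \<subseteq> verts R)"
      using T verts_face_of_subset[of T R] by blast
  qed
  then show ?case by simp
qed

end
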